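(* Let $h:\mathbb{R}^n\to\mathbb{R}$ be a differentiable function, $\overline{x}\in\operatorname{argmin}_{\mathbb{R}^n}h$, and $\gamma\ge 0$. Then $h$ is (strongly) star quasiconvex with modulus $\gamma$ with respect to $\overline{x}$ if and only if for every $y\in\mathbb{R}^n$, $$\langle\nabla h(y),y-\overline{x}\rangle\ge\frac{\gamma}{2}\|y-\overline{x}\|^2.$$
   Context: $\operatorname{argmin}_{\mathbb{R}^n}h$ is the set of global minimizers of $h$. For $\overline{x}\in\operatorname{argmin}_{\mathbb{R}^n}h$ and $\gamma\ge0$, $h$ is (strongly) star quasiconvex with modulus $\gamma$ with respect to $\overline{x}$ if for every $y\in\mathbb{R}^n$ and $\lambda\in[0,1]$, $$h(\lambda\overline{x}+(1-\lambda)y)\le h(y)-\lambda(1-\lambda)\frac{\gamma}{2}\|y-\overline{x}\|^2$$ ("strongly" corresponds to $\gamma>0$). *)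

theory Defs
  imports "HOL-Analysis.Analysis"
begin

definition argmin_set :: "('a \<Rightarrow> real) \<Rightarrow> 'a set" where
  "argmin_set h = {x. is_arg_min h (\<lambda>_. True) x}"

(* Meaningful only where h is differentiable; elsewhere the value is unspecified. *)
definition gradient :: "('a::real_inner \<Rightarrow> real) \<Rightarrow> 'a \<Rightarrow> 'a" where
  "gradient h x = (THE D. GDERIV h x :> D)"

lemma gradient_eqI:
  assumes "GDERIV h x :> D"
  shows "gradient h x = D"
  unfolding gradient_def
proof (rule the_equality)
  fix E assume "GDERIV h x :> E"
  with assms have "(\<lambda>v. v \<bullet> D) = (\<lambda>v. v \<bullet> E)"
    unfolding gderiv_def by (rule has_derivative_unique)
  then have "\<And>v. v \<bullet> (E - D) = 0"
    by (metis inner_diff_right right_minus_eq)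
  then show "E = D"
    by (metis inner_eq_zero_iff right_minus_eq)
qed (fact assms)

lemma gderiv_gradient:
  fixes h :: "'a::euclidean_space \<Rightarrow> real"
  assumes "h differentiable (at x)"
  shows "GDERIV h x :> gradient h x"
proof -
  from assms obtain f' where f': "(h has_derivative f') (at x)"
    unfolding differentiable_def by blast
  then have "linear f'"
    by (rule has_derivative_linear)
  then have "f' v = v \<bullet> adjoint f' 1" for v
    using adjoint_works[of f' v 1] by simp
  then have "f' = (\<lambda>v. v \<bullet> adjoint f' 1)" by blast
  with f' have "GDERIV h x :> adjoint f' 1"
    unfolding gderiv_def by simp
  then show ?thesis
    using gradient_eqI by metis
qed

(* The notion is only used for xbar in argmin_set h and gamma >= 0;
   gamma > 0 is the strong case. *)
definition star_quasiconvex ::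
  "('a::real_inner \<Rightarrow> real) \<Rightarrow> real \<Rightarrow> 'a \<Rightarrow> bool" where
  "star_quasiconvex h \<gamma> xbar \<longleftrightarrow>
     (\<forall>y. \<forall>t\<in>{0..1}.
        h (t *\<^sub>R xbar + (1 - t) *\<^sub>R y) \<le> h y - t * (1 - t) * (\<gamma> / 2) * (norm (y - xbar))\<^sup>2)"

end

(* Restrict h to the ray phi(s) = h (xbar + s (y - xbar)) and put c = gamma/2 |y - xbar|^2.
   Star quasiconvexity says that h y - phi(1 - t) - t (1 - t) c is nonnegative on [0,1]; it vanishes
   at t = 0, so its derivative phi'(1) - c there is nonnegative.  Conversely, the gradient inequality
   at the points of the ray gives phi'(s) >= c s for s > 0, so phi(s) - c s^2 / 2 is nondecreasing,
   and (1 - s^2) / 2 >= s (1 - s). *)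
theory Submission
  imports Defs
begin

lemma DERIV_along_ray:
  fixes h :: "'a::euclidean_space \<Rightarrow> real"
  assumes "\<forall>y. h differentiable (at y)"
  shows "((\<lambda>s. h (x + s *\<^sub>R d)) has_real_derivative gradient h (x + s *\<^sub>R d) \<bullet> d) (at s)"
proof -
  have h: "(h has_derivative (\<lambda>v. v \<bullet> gradient h (x + s *\<^sub>R d))) (at (x + s *\<^sub>R d))"
    using gderiv_gradient assms unfolding gderiv_def by blast
  have "((\<lambda>s. x + s *\<^sub>R d) has_derivative (\<lambda>r. r *\<^sub>R d)) (at s)"
    by (auto intro!: derivative_eq_intros)
  from has_derivative_compose[OF this h] show ?thesis
    by (simp add: has_field_derivative_def inner_commute mult.commute[of _ "_ \<bullet> _"])
qed

text \<open>Puts the convex combination on the ray from \<open>x\<close> through \<open>y\<close> at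
  parameter \<open>1 - t\<close>, so that both directions reduce to calculus in one real
  variable.\<close>

lemma star_quasiconvex_iff_along_rays:
  "star_quasiconvex h \<gamma> x \<longleftrightarrow>
    (\<forall>y. \<forall>t\<in>{0..1}. h (x + (1 - t) *\<^sub>R (y - x)) \<le> h y - t * (1 - t) * (\<gamma> / 2 * (norm (y - x))\<^sup>2))"
proof -
  have "t *\<^sub>R x + (1 - t) *\<^sub>R y = x + (1 - t) *\<^sub>R (y - x)" for y t
    by (simp add: algebra_simps)
  then show ?thesis
    by (simp add: star_quasiconvex_def mult.assoc)
qed

lemma star_quasiconvex_imp_gradient_ge:
  fixes h :: "'a::euclidean_space \<Rightarrow> real"
  assumes diff: "\<forall>y. h differentiable (at y)" and star: "star_quasiconvex h \<gamma> x"
  shows "\<gamma> / 2 * (norm (y - x))\<^sup>2 \<le> gradient h y \<bullet> (y - x)"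
proof (rule ccontr)
  define c where "c = \<gamma> / 2 * (norm (y - x))\<^sup>2"
  define F where "F t = h y - h (x + (1 - t) *\<^sub>R (y - x)) - t * (1 - t) * c" for t
  assume "\<not> ?thesis"
  then have neg: "gradient h y \<bullet> (y - x) - c < 0"
    by (simp add: c_def)
  \<comment> \<open>The point is written \<open>1 - 0\<close> so that the chain rule can match it
    with the inner map \<open>1 - t\<close> at \<open>t = 0\<close>.\<close>
  have "((\<lambda>s. h (x + s *\<^sub>R (y - x))) has_real_derivative gradient h y \<bullet> (y - x)) (at (1 - 0))"
    using DERIV_along_ray[OF diff, of x "y - x" 1] by simp
  moreover have "((\<lambda>t. 1 - t) has_real_derivative -1) (at (0::real))"
    by (auto intro!: derivative_eq_intros)
  ultimately have "((\<lambda>t. h (x + (1 - t) *\<^sub>R (y - x))) has_real_derivative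
      gradient h y \<bullet> (y - x) * (-1)) (at 0)"
    by (rule DERIV_chain2)
  then have "(F has_real_derivative gradient h y \<bullet> (y - x) - c) (at 0)"
    unfolding F_def by (auto intro!: derivative_eq_intros)
  \<comment> \<open>A negative slope at 0 pushes \<open>F\<close> below \<open>F 0 = 0\<close> just
    to the right, where star quasiconvexity keeps it nonnegative.\<close>
  from DERIV_neg_dec_right[OF this neg] obtain e
    where e: "e > 0" "\<And>t. 0 < t \<Longrightarrow> t < e \<Longrightarrow> F t < F 0"
    by auto
  \<comment> \<open>Halving \<open>e\<close> keeps \<open>t\<close> strictly inside the range of
    decrease; the cap 1 keeps it in the range of the hypothesis.\<close>
  define t where "t = min 1 (e / 2)"
  have t: "0 < t" "t < e" "t \<le> 1"
    using e(1) by (auto simp: t_def)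
  have "0 \<le> F t"
    using star[unfolded star_quasiconvex_iff_along_rays, rule_format, of t y] t
    by (simp add: F_def c_def)
  moreover have "F 0 = 0"
    by (simp add: F_def)
  ultimately show False
    using e(2)[of t] t by simp
qed

lemma gradient_ge_imp_star_quasiconvex:
  fixes h :: "'a::euclidean_space \<Rightarrow> real"
  assumes diff: "\<forall>y. h differentiable (at y)"
    and grad: "\<And>y. \<gamma> / 2 * (norm (y - x))\<^sup>2 \<le> gradient h y \<bullet> (y - x)"
    and "\<gamma> \<ge> 0"
  shows "star_quasiconvex h \<gamma> x"
  unfolding star_quasiconvex_iff_along_rays
proof (intro allI ballI)
  fix y and t :: real
  assume "t \<in> {0..1}"
  then have t: "0 \<le> t" "t \<le> 1"
    by auto
  define d where "d = y - x"
  define c where "c = \<gamma> / 2 * (norm d)\<^sup>2"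
  have "c \<ge> 0"
    using \<open>\<gamma> \<ge> 0\<close> by (simp add: c_def)
  define \<psi> where "\<psi> s = h (x + s *\<^sub>R d) - c / 2 * s\<^sup>2" for s
  have deriv: "(\<psi> has_real_derivative gradient h (x + s *\<^sub>R d) \<bullet> d - c * s) (at s)" for s
    unfolding \<psi>_def by (auto intro!: derivative_eq_intros DERIV_along_ray[OF diff])
  have slope: "0 \<le> gradient h (x + s *\<^sub>R d) \<bullet> d - c * s" if "s > 0" for s
  proof -
    \<comment> \<open>The displacement from \<open>x\<close> is \<open>s *\<^sub>R d\<close>, so the
      hypothesis carries \<open>s\<^sup>2\<close> on the left and \<open>s\<close> on the right; one
      factor \<open>s > 0\<close> cancels.\<close>
    have "s * (c * s) \<le> s * (gradient h (x + s *\<^sub>R d) \<bullet> d)"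
      using grad[of "x + s *\<^sub>R d"] by (simp add: c_def power2_eq_square mult_ac)
    then show ?thesis
      using that by simp
  qed
  have "\<psi> (1 - t) \<le> \<psi> 1"
  proof (rule DERIV_nonneg_imp_increasing_open[where f = \<psi>])
    fix s
    assume "1 - t < s"
    then show "\<exists>z. (\<psi> has_real_derivative z) (at s) \<and> 0 \<le> z"
      using deriv slope[of s] t by force
  next
    show "continuous_on {1 - t..1} \<psi>"
      by (rule DERIV_continuous_on) (rule has_field_derivative_at_within[OF deriv])
  qed (use t in simp)
  then have "h (x + (1 - t) *\<^sub>R d) \<le> h y - c / 2 * (1 - (1 - t)\<^sup>2)"
    by (simp add: \<psi>_def d_def algebra_simps)
  \<comment> \<open>Uses 1 - (1 - t)^2 = 2 t (1 - t) + t^2; the surplus square is then dropped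
    because \<open>c\<close> is nonnegative.\<close>
  also have "\<dots> = h y - t * (1 - t) * c - c / 2 * t\<^sup>2"
    by (simp add: field_simps power2_eq_square)
  also have "\<dots> \<le> h y - t * (1 - t) * c"
    using \<open>c \<ge> 0\<close> by simp
  finally show "h (x + (1 - t) *\<^sub>R (y - x)) \<le> h y - t * (1 - t) * (\<gamma> / 2 * (norm (y - x))\<^sup>2)"
    by (simp add: c_def d_def)
qed

theorem proposition27:
  fixes h :: "real ^ 'n \<Rightarrow> real" and xbar :: "real ^ 'n" and \<gamma> :: real
  assumes "\<forall>y. h differentiable (at y)"
    and "xbar \<in> argmin_set h"
    and "\<gamma> \<ge> 0"
  shows "star_quasiconvex h \<gamma> xbar \<longleftrightarrow>
    (\<forall>y. gradient h y \<bullet> (y - xbar) \<ge> \<gamma> / 2 * (norm (y - xbar))\<^sup>2)"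
  using assms(1,3) star_quasiconvex_imp_gradient_ge gradient_ge_imp_star_quasiconvex by blast

end
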